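(* Let $T_m$ be a knot vector as in the context. The shifted Legendre polynomials $L_{i,n}(t)=\frac{1}{i!}\frac{d^i}{dt^i}\big[(1-t)^it^i\big]$ $(i=0,1,\ldots,n)$ can be written on $[0,1]$ in terms of the B-spline functions of degree $n$ over $T_m$ as $$L_{0,n}(t)=\sum_{j=0}^{n+m}N_{-n+j,n}^m(t),\qquad L_{i,n}(t)=\sum_{j=0}^{n+m}\phi_{j,i}N_{-n+j,n}^m(t)\quad(i=1,2,\ldots,n),$$ where $$\phi_{j,i}:=\sum_{h=0}^{i}\frac{(-i)_h(i+1)_h}{\binom{n}{h}(h!)^2}\sum_{\substack{S\subset A_j\\|S|=h}}\ \prod_{s\in S}t_s^{(m)},\qquad A_j:=\{-n+j+1,-n+j+2,\ldots,j\}.$$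
   Context: Knots: $0<t_1\le t_2\le\cdots\le t_m<1$, with no value occurring more than $n$ times among $t_1,\ldots,t_m$. The knot vector $T_m=(t^{(m)}_{-n},t^{(m)}_{-n+1},\ldots,t^{(m)}_{n+m+1})$ is given by $t^{(m)}_{-n}=\cdots=t^{(m)}_0=0$, $t^{(m)}_i=t_i$ for $1\le i\le m$, and $t^{(m)}_{m+1}=\cdots=t^{(m)}_{n+m+1}=1$. The B-splines over $T_m$ are defined by $N_{i,0}^m(t)=1$ if $t^{(m)}_i\le t<t^{(m)}_{i+1}$ and $0$ otherwise, and for $d\ge1$ $$N_{i,d}^m(t)=\frac{t-t_i^{(m)}}{t_{i+d}^{(m)}-t_i^{(m)}}N_{i,d-1}^m(t)+\frac{t_{i+d+1}^{(m)}-t}{t_{i+d+1}^{(m)}-t_{i+1}^{(m)}}N_{i+1,d-1}^m(t),$$ a quotient with zero denominator being $0$; values at $t=1$ are understood as limits from the left. Pochhammer symbol: $(h)_0=1$, $(h)_l=h(h+1)\cdots(h+l-1)$. *)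

theory Defs
  imports "HOL-Analysis.Analysis"
begin

text \<open>
  The knot vector \<open>(t\<^sub>-\<^sub>n, \<dots>, t\<^sub>n\<^sub>+\<^sub>m\<^sub>+\<^sub>1)\<close> with interior knots \<open>t 1, \<dots>, t m\<close>. It is represented as a
  total function on the integers; only the indices from \<open>-n\<close> to \<open>n + m + 1\<close> are ever
  used in degree \<open>n\<close>, so the length of the two constant tails need not be recorded.
\<close>

definition knot :: "nat \<Rightarrow> (nat \<Rightarrow> real) \<Rightarrow> int \<Rightarrow> real" where
  "knot m t i = (if i \<le> 0 then 0 else if i \<le> int m then t (nat i) else 1)"

text \<open>
  The Cox--de Boor recursion over an arbitrary knot sequence \<open>\<tau>\<close>. The convention that a
  quotient with zero denominator is \<open>0\<close> agrees with division by zero in HOL.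
\<close>

fun bspline_rec :: "(int \<Rightarrow> real) \<Rightarrow> int \<Rightarrow> nat \<Rightarrow> real \<Rightarrow> real" where
  "bspline_rec \<tau> i 0 x = (if \<tau> i \<le> x \<and> x < \<tau> (i + 1) then 1 else 0)"
| "bspline_rec \<tau> i (Suc d) x =
     (x - \<tau> i) / (\<tau> (i + int (Suc d)) - \<tau> i) * bspline_rec \<tau> i d x
   + (\<tau> (i + int (Suc d) + 1) - x) / (\<tau> (i + int (Suc d) + 1) - \<tau> (i + 1))
       * bspline_rec \<tau> (i + 1) d x"

text \<open>
  The recursion uses half-open knot intervals, so at the right end point \<open>1\<close> the value is
  the limit from the left, which exists by the lemma that follows.
\<close>

definition bspline :: "(int \<Rightarrow> real) \<Rightarrow> int \<Rightarrow> nat \<Rightarrow> real \<Rightarrow> real" where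
  "bspline \<tau> i d x =
     (if x = 1 then Lim (at_left 1) (bspline_rec \<tau> i d) else bspline_rec \<tau> i d x)"

lemma bspline_rec_left_limit: "\<exists>l. (bspline_rec \<tau> i d \<longlongrightarrow> l) (at_left 1)"
proof (induction d arbitrary: i)
  case 0
  have less: "eventually (\<lambda>x::real. (x < c) = (1 \<le> c)) (at_left 1)" for c
  proof (cases "1 \<le> c")
    case True
    then show ?thesis
      by (auto simp: eventually_at_filter)
  next
    case False
    then have "eventually (\<lambda>x. x \<in> {c<..<1}) (at_left 1)"
      by (intro eventually_at_left_real) auto
    then show ?thesis
      by eventually_elim (use False in auto)
  qed
  have "eventually (\<lambda>x. bspline_rec \<tau> i 0 x = (if \<tau> i < 1 \<and> 1 \<le> \<tau> (i + 1) then 1 else 0))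
          (at_left 1)"
    using less[of "\<tau> i"] less[of "\<tau> (i + 1)"] by eventually_elim auto
  then show ?case
    by (blast intro: tendsto_eventually)
next
  case (Suc d)
  obtain a b where "(bspline_rec \<tau> i d \<longlongrightarrow> a) (at_left 1)"
    and "(bspline_rec \<tau> (i + 1) d \<longlongrightarrow> b) (at_left 1)"
    using Suc.IH by blast
  then show ?case
    unfolding bspline_rec.simps divide_inverse
    by (intro exI) (rule tendsto_intros | assumption)+
qed

definition shifted_legendre :: "nat \<Rightarrow> real \<Rightarrow> real" where
  "shifted_legendre i x = 1 / fact i * (deriv ^^ i) (\<lambda>y. (1 - y) ^ i * y ^ i) x"

definition knot_indices :: "nat \<Rightarrow> nat \<Rightarrow> int set" where
  "knot_indices n j = {- int n + int j + 1..int j}"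

text \<open>
  The inner sum ranges over sets of knot indices, not of knot values: repeated knots count with
  their multiplicity.
\<close>

definition legendre_coeff :: "nat \<Rightarrow> (int \<Rightarrow> real) \<Rightarrow> nat \<Rightarrow> nat \<Rightarrow> real" where
  "legendre_coeff n \<tau> j i =
     (\<Sum>h=0..i. pochhammer (- real i) h * pochhammer (real i + 1) h
                  / (real (n choose h) * (fact h)\<^sup>2)
              * (\<Sum>S | S \<subseteq> knot_indices n j \<and> card S = h. \<Prod>s\<in>S. \<tau> s))"

end

theory Submission
  imports Defs
begin

text \<open>
  The B-spline \<open>N\<^sub>i\<^sub>,\<^sub>d\<close> has the interior knots \<open>\<tau> (i + 1), \<dots>, \<tau> (i + d)\<close>. Marsden's identity
  says that the B-splines, weighted by \<open>\<Prod>s (1 + u * \<tau> s)\<close> over these knots, add up to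
  \<open>(1 + u * x) ^ d\<close>, for every \<open>u\<close> (\<open>marsden_identity\<close>). Both sides are polynomials in \<open>u\<close>, so
  their coefficients agree: \<open>(d choose h) * x ^ h\<close> is the combination of B-splines whose
  coefficients are the elementary symmetric sums of degree \<open>h\<close> of the interior knots
  (\<open>power_eq_sum_bspline_rec\<close>).

  The shifted Legendre polynomial is the terminating hypergeometric series with coefficients
  \<open>(-i)\<^sub>h (i + 1)\<^sub>h / (h!)\<^sup>2\<close>, by the Rodrigues formula (\<open>shifted_legendre_eq_sum\<close>). Replacing each
  power of \<open>x\<close> by its B-spline expansion gives the claimed coefficients on \<open>[0, 1)\<close>, and the end
  point \<open>1\<close> follows by passing to the limit from the left on both sides.
\<close>

section \<open>Marsden's identity\<close>

text \<open>
  The support also settles the convention on zero denominators: a quotient whose two knots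
  coincide only ever multiplies a B-spline with empty support.
\<close>

lemma bspline_rec_support:
  assumes "mono \<tau>" and "bspline_rec \<tau> i d x \<noteq> 0"
  shows "\<tau> i \<le> x \<and> x < \<tau> (i + int d + 1)"
  using assms(2)
proof (induction d arbitrary: i)
  case 0
  then show ?case by (simp split: if_splits)
next
  case (Suc d)
  have "bspline_rec \<tau> i d x \<noteq> 0 \<or> bspline_rec \<tau> (i + 1) d x \<noteq> 0"
    using Suc.prems by auto
  then show ?case
  proof
    assume "bspline_rec \<tau> i d x \<noteq> 0"
    then have "\<tau> i \<le> x \<and> x < \<tau> (i + int d + 1)" by (rule Suc.IH)
    moreover have "\<tau> (i + int d + 1) \<le> \<tau> (i + int (Suc d) + 1)"
      using \<open>mono \<tau>\<close> by (rule monoD) simp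
    ultimately show ?thesis by linarith
  next
    assume "bspline_rec \<tau> (i + 1) d x \<noteq> 0"
    then have "\<tau> (i + 1) \<le> x \<and> x < \<tau> (i + 1 + int d + 1)" by (rule Suc.IH)
    moreover have "\<tau> i \<le> \<tau> (i + 1)"
      using \<open>mono \<tau>\<close> by (rule monoD) simp
    moreover have "i + 1 + int d + 1 = i + int (Suc d) + 1" by simp
    ultimately show ?thesis by (metis order_trans)
  qed
qed

text \<open>
  On one knot span only \<open>d + 1\<close> B-splines of degree \<open>d\<close> are alive, so all sums below can be taken
  over this window or over any larger index range.
\<close>

lemma bspline_rec_eq_0_outside:
  assumes "mono \<tau>" and "\<tau> p \<le> x" and "x < \<tau> (p + 1)" and "i \<notin> {p - int d..p}"
  shows "bspline_rec \<tau> i d x = 0"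
proof (rule ccontr)
  assume "bspline_rec \<tau> i d x \<noteq> 0"
  then have *: "\<tau> i \<le> x" "x < \<tau> (i + int d + 1)"
    using bspline_rec_support[OF \<open>mono \<tau>\<close>] by blast+
  consider "i + int d + 1 \<le> p" | "p + 1 \<le> i" using assms(4) by force
  then show False
  proof cases
    case 1
    then have "\<tau> (i + int d + 1) \<le> \<tau> p" by (rule monoD[OF \<open>mono \<tau>\<close>])
    then show False using * assms by linarith
  next
    case 2
    then have "\<tau> (p + 1) \<le> \<tau> i" by (rule monoD[OF \<open>mono \<tau>\<close>])
    then show False using * assms by linarith
  qed
qed

text \<open>
  Write the two weights of the recursion as \<open>l i\<close> and \<open>r i\<close>, the affine coordinates of \<open>x\<close> with
  respect to \<open>\<tau> i\<close> and \<open>\<tau> (i + d + 1)\<close>. After the recursion is applied, \<open>N\<^sub>i\<^sub>,\<^sub>d\<close> occurs twice,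
  with the knot products of \<open>i\<close> and of \<open>i - 1\<close>. These share all factors but one, which is
  \<open>1 + u * \<tau> (i + d + 1)\<close> and \<open>1 + u * \<tau> i\<close> respectively; the affine function \<open>1 + u * y\<close> is
  interpolated by the weights, so the two terms together contribute the factor \<open>1 + u * x\<close>.
\<close>

lemma marsden_identity:
  fixes \<tau> :: "int \<Rightarrow> real" and u x :: real
  assumes "mono \<tau>" and "\<tau> p \<le> x" and "x < \<tau> (p + 1)"
  shows "(\<Sum>i=p - int d..p. (\<Prod>s=i + 1..i + int d. 1 + u * \<tau> s) * bspline_rec \<tau> i d x)
           = (1 + u * x) ^ d"
proof (induction d)
  case 0
  then show ?case using assms by simp
next
  case (Suc d)
  define B where "B i = bspline_rec \<tau> i d x" for i
  define R where "R i = (\<Prod>s=i + 1..i + int d. 1 + u * \<tau> s)" for i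
  define P where "P i = (\<Prod>s=i + 1..i + int (Suc d). 1 + u * \<tau> s)" for i
  define l where "l i = (x - \<tau> i) / (\<tau> (i + int (Suc d)) - \<tau> i)" for i
  define r where "r i = (\<tau> (i + int (Suc d)) - x) / (\<tau> (i + int (Suc d)) - \<tau> i)" for i
  have rec: "bspline_rec \<tau> i (Suc d) x = l i * B i + r (i + 1) * B (i + 1)" for i
    unfolding bspline_rec.simps(2) l_def r_def B_def by (simp add: algebra_simps)
  have B0: "B i = 0" if "i \<notin> {p - int d..p}" for i
    unfolding B_def using bspline_rec_eq_0_outside[OF assms that] .
  have P_last: "P i = R i * (1 + u * \<tau> (i + int (Suc d)))" for i
  proof -
    have "{i + 1..i + int (Suc d)} = insert (i + int (Suc d)) {i + 1..i + int d}" by auto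
    then show ?thesis unfolding P_def R_def by (simp add: mult.commute)
  qed
  have P_first: "P (i - 1) = (1 + u * \<tau> i) * R i" for i
  proof -
    have "{i - 1 + 1..i - 1 + int (Suc d)} = insert i {i + 1..i + int d}" by auto
    then show ?thesis unfolding P_def R_def by simp
  qed
  \<comment> \<open>If \<open>B i\<close> does not vanish, its support is nonempty and the two outer knots differ.\<close>
  have key: "P i * (l i * B i) + P (i - 1) * (r i * B i) = (1 + u * x) * (R i * B i)" for i
  proof (cases "B i = 0")
    case False
    then have "\<tau> (i + int (Suc d)) - \<tau> i \<noteq> 0"
      using bspline_rec_support[OF \<open>mono \<tau>\<close>, of i d x] unfolding B_def
      by (simp add: algebra_simps)
    then have "(1 + u * \<tau> (i + int (Suc d))) * l i + (1 + u * \<tau> i) * r i = 1 + u * x"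
      unfolding l_def r_def by (simp add: divide_simps) (simp add: algebra_simps)
    moreover have "P i * (l i * B i) + P (i - 1) * (r i * B i) =
        ((1 + u * \<tau> (i + int (Suc d))) * l i + (1 + u * \<tau> i) * r i) * (R i * B i)"
      unfolding P_last[of i] P_first[of i] by (simp only: distrib_left distrib_right mult_ac add_ac)
    ultimately show ?thesis by simp
  qed simp
  have "(\<Sum>i=p - int (Suc d)..p. P i * bspline_rec \<tau> i (Suc d) x) =
        (\<Sum>i=p - int (Suc d)..p. P i * (l i * B i))
        + (\<Sum>i=p - int (Suc d)..p. P i * (r (i + 1) * B (i + 1)))"
    by (simp only: rec distrib_left sum.distrib)
  \<comment> \<open>Both sums run over the window of degree \<open>d + 1\<close>, which exceeds that of degree \<open>d\<close> by one index:
      on the left in the first sum, and after the shift on the right in the second.\<close>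
  also have "(\<Sum>i=p - int (Suc d)..p. P i * (l i * B i)) = (\<Sum>i=p - int d..p. P i * (l i * B i))"
    by (rule sum.mono_neutral_right) (auto simp: B0)
  also have "(\<Sum>i=p - int (Suc d)..p. P i * (r (i + 1) * B (i + 1))) =
             (\<Sum>i=p - int d..p + 1. P (i - 1) * (r i * B i))"
    by (rule sum.reindex_bij_witness[of _ "\<lambda>i. i - 1" "\<lambda>i. i + 1"]) auto
  also have "\<dots> = (\<Sum>i=p - int d..p. P (i - 1) * (r i * B i))"
    by (rule sum.mono_neutral_right) (auto simp: B0)
  also have "(\<Sum>i=p - int d..p. P i * (l i * B i)) + \<dots> = (\<Sum>i=p - int d..p. (1 + u * x) * (R i * B i))"
    by (simp only: key flip: sum.distrib)
  also have "\<dots> = (1 + u * x) * (1 + u * x) ^ d"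
    using Suc.IH unfolding R_def B_def by (simp flip: sum_distrib_left)
  finally show ?case unfolding P_def by simp
qed

section \<open>Monomials as combinations of B-splines\<close>

definition elem_sym :: "nat \<Rightarrow> 'a set \<Rightarrow> ('a \<Rightarrow> real) \<Rightarrow> real" where
  "elem_sym h A f = (\<Sum>S | S \<subseteq> A \<and> card S = h. \<Prod>s\<in>S. f s)"

lemma prod_one_plus_eq_sum_elem_sym:
  assumes "finite A"
  shows "(\<Prod>s\<in>A. 1 + u * f s) = (\<Sum>h\<le>card A. elem_sym h A f * u ^ h)"
proof -
  have "(\<Prod>s\<in>A. 1 + u * f s) = (\<Sum>S\<in>Pow A. u ^ card S * (\<Prod>s\<in>S. f s))"
    using prod_add[OF assms, of "\<lambda>s. u * f s" "\<lambda>_. 1"]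
    by (simp add: add.commute prod.distrib)
  also have "\<dots> = (\<Sum>h\<le>card A. \<Sum>S | S \<in> Pow A \<and> card S = h. u ^ card S * (\<Prod>s\<in>S. f s))"
    by (rule sum.group[symmetric]) (auto simp: assms card_mono)
  also have "\<dots> = (\<Sum>h\<le>card A. elem_sym h A f * u ^ h)"
    unfolding elem_sym_def by (intro sum.cong) (auto simp: sum_distrib_left mult.commute)
  finally show ?thesis .
qed

text \<open>Comparison of the coefficients of \<open>u ^ h\<close> in Marsden's identity.\<close>

lemma power_eq_sum_bspline_rec:
  fixes \<tau> :: "int \<Rightarrow> real"
  assumes "mono \<tau>" and "\<tau> p \<le> x" and "x < \<tau> (p + 1)" and "h \<le> d"
  shows "real (d choose h) * x ^ h =
           (\<Sum>i=p - int d..p. elem_sym h {i + 1..i + int d} \<tau> * bspline_rec \<tau> i d x)"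
proof -
  have "(\<Sum>h\<le>d. (real (d choose h) * x ^ h) * u ^ h) =
        (\<Sum>h\<le>d. (\<Sum>i=p - int d..p. elem_sym h {i + 1..i + int d} \<tau> * bspline_rec \<tau> i d x) * u ^ h)"
    for u :: real
  proof -
    have "(\<Sum>h\<le>d. (real (d choose h) * x ^ h) * u ^ h) = (u * x + 1) ^ d"
      by (simp add: binomial_ring power_mult_distrib mult_ac)
    also have "\<dots> = (\<Sum>i=p - int d..p. (\<Prod>s=i + 1..i + int d. 1 + u * \<tau> s) * bspline_rec \<tau> i d x)"
      using marsden_identity[OF assms(1-3), where d = d and u = u] by (simp add: add.commute)
    also have "\<dots> = (\<Sum>i=p - int d..p. \<Sum>h\<le>d.
        elem_sym h {i + 1..i + int d} \<tau> * bspline_rec \<tau> i d x * u ^ h)"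
      by (simp add: prod_one_plus_eq_sum_elem_sym sum_distrib_left mult_ac)
    also have "\<dots> = (\<Sum>h\<le>d. (\<Sum>i=p - int d..p.
        elem_sym h {i + 1..i + int d} \<tau> * bspline_rec \<tau> i d x) * u ^ h)"
      by (subst sum.swap) (simp add: sum_distrib_right)
    finally show ?thesis .
  qed
  then show ?thesis using \<open>h \<le> d\<close>
    using polyfun_eq_coeffs[of "\<lambda>h. real (d choose h) * x ^ h" d
      "\<lambda>h. \<Sum>i=p - int d..p. elem_sym h {i + 1..i + int d} \<tau> * bspline_rec \<tau> i d x"]
    by blast
qed

section \<open>Shifted Legendre polynomials in the monomial basis\<close>

lemma higher_deriv_poly: "(deriv ^^ k) (poly p) = poly ((pderiv ^^ k) p)" for p :: "real poly"
proof (induction k)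
  case (Suc k)
  have "deriv (poly q) = poly (pderiv q)" for q :: "real poly"
    by (intro ext DERIV_imp_deriv poly_DERIV)
  then show ?case using Suc by simp
qed simp

lemma pochhammer_neg_of_nat:
  "pochhammer (- real i) h = (-1) ^ h * fact h * real (i choose h)"
  using gbinomial_pochhammer[of "real i" h]
  by (simp add: binomial_gbinomial flip: power_mult_distrib)

text \<open>
  By the binomial theorem, the coefficient of \<open>y ^ (h + i)\<close> in \<open>(1 - y) ^ i * y ^ i\<close> is
  \<open>(-1) ^ h * (i choose h)\<close>, and differentiating \<open>i\<close> times multiplies it by \<open>(h + i)! / h!\<close>.
\<close>

lemma shifted_legendre_eq_sum:
  "shifted_legendre i x =
     (\<Sum>h\<le>i. pochhammer (- real i) h * pochhammer (real i + 1) h / (fact h)\<^sup>2 * x ^ h)"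
proof -
  define q :: "real poly" where "q = (pderiv ^^ i) (monom 1 i * [:1, -1:] ^ i)"
  have "(\<lambda>y::real. (1 - y) ^ i * y ^ i) = poly (monom 1 i * [:1, -1:] ^ i)"
    by (auto simp: poly_monom)
  then have "shifted_legendre i x = poly q x / fact i"
    unfolding shifted_legendre_def q_def by (simp add: higher_deriv_poly)
  also have "poly q x = (\<Sum>h\<le>i. coeff q h * x ^ h)"
  proof -
    have "degree (monom 1 i * [:1, -1:] ^ i :: real poly) = i + i"
      by (simp add: degree_mult_eq degree_monom_eq degree_power_eq)
    then have "degree q \<le> i" unfolding q_def by (simp add: degree_higher_pderiv)
    then show ?thesis unfolding poly_altdef
      by (intro sum.mono_neutral_left) (auto simp: coeff_eq_0)
  qed
  also have "\<dots> / fact i = (\<Sum>h\<le>i. coeff q h / fact i * x ^ h)"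
    by (simp add: sum_divide_distrib)
  also have "\<dots> = (\<Sum>h\<le>i. pochhammer (- real i) h * pochhammer (real i + 1) h / (fact h)\<^sup>2 * x ^ h)"
  proof (intro sum.cong refl arg_cong[where f = "\<lambda>c. c * x ^ _"])
    fix h assume "h \<in> {..i}"
    then have "h \<le> i" by simp
    have "coeff q h = pochhammer (real h + 1) i * (real (i choose h) * (-1) ^ h)"
      unfolding q_def coeff_higher_pderiv coeff_monom_mult
      using \<open>h \<le> i\<close> by (simp add: coeff_linear_poly_power add.commute)
    moreover have "fact h * pochhammer (real h + 1) i = fact (h + i)"
      and "fact i * pochhammer (real i + 1) h = fact (h + i)"
      using pochhammer_product'[of "1::real" h i] pochhammer_product'[of "1::real" i h]
      by (simp_all add: pochhammer_fact add.commute)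
    ultimately have "fact h * coeff q h = fact i * pochhammer (real i + 1) h * (real (i choose h) * (-1) ^ h)"
      by (metis mult.assoc)
    then show "coeff q h / fact i = pochhammer (- real i) h * pochhammer (real i + 1) h / (fact h)\<^sup>2"
      by (simp add: pochhammer_neg_of_nat field_simps power2_eq_square)
  qed
  finally show ?thesis .
qed

section \<open>Shifted Legendre polynomials in the B-spline basis\<close>

lemma mono_knot:
  assumes "\<And>k. k \<in> {1..m} \<Longrightarrow> 0 < t k \<and> t k < 1" and "mono_on {1..m} t"
  shows "mono (knot m t)"
proof (rule monoI)
  fix a b :: int
  assume "a \<le> b"
  consider "a \<le> 0" | "0 < a" "b \<le> int m" | "int m < b" "0 < a" by linarith
  then show "knot m t a \<le> knot m t b"
  proof cases
    case 1
    then show ?thesis using assms(1)[of "nat b"] by (fastforce simp: knot_def)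
  next
    case 2
    then have "t (nat a) \<le> t (nat b)"
      using \<open>a \<le> b\<close> by (intro mono_onD[OF assms(2)]) auto
    then show ?thesis using 2 \<open>a \<le> b\<close> by (simp add: knot_def)
  next
    case 3
    then show ?thesis using assms(1)[of "nat a"] by (fastforce simp: knot_def)
  qed
qed

text \<open>
  The index is found as the predecessor of the first knot to the right of \<open>x\<close>; among repeated
  knots this picks the last one, so the span is nondegenerate.
\<close>

lemma ex_knot_span:
  assumes "0 \<le> x" and "x < 1"
  obtains p where "0 \<le> p" "p \<le> int m" "knot m t p \<le> x" "x < knot m t (p + 1)"
proof -
  define k where "k = (LEAST k. x < knot m t (int k))"
  have above: "x < knot m t (int (Suc m))" using assms by (simp add: knot_def)
  have "x < knot m t (int k)" unfolding k_def by (rule LeastI[where P = "\<lambda>k. x < knot m t (int k)", OF above])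
  moreover have "k \<le> Suc m" unfolding k_def by (rule Least_le[where P = "\<lambda>k. x < knot m t (int k)", OF above])
  moreover have "k \<noteq> 0"
    using \<open>x < knot m t (int k)\<close> assms(1) by (cases k) (auto simp: knot_def)
  moreover have "\<not> x < knot m t (int (k - 1))"
    using \<open>k \<noteq> 0\<close> unfolding k_def by (intro not_less_Least) simp
  ultimately show ?thesis
    by (intro that[of "int (k - 1)"]) (auto simp: of_nat_diff)
qed

text \<open>
  Every knot span in \<open>[0, 1)\<close> starts at an index between \<open>0\<close> and \<open>m\<close>, so the window of live
  B-splines of degree \<open>n\<close> lies in \<open>{-n..m}\<close>. This range is independent of \<open>x\<close>.
\<close>

lemma power_eq_sum_bspline_rec_knot:
  assumes "mono (knot m t)" and "0 \<le> x" and "x < 1" and "h \<le> n"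
  shows "real (n choose h) * x ^ h =
           (\<Sum>j=0..n + m. elem_sym h (knot_indices n j) (knot m t)
                            * bspline_rec (knot m t) (- int n + int j) n x)"
proof -
  obtain p where p: "0 \<le> p" "p \<le> int m" "knot m t p \<le> x" "x < knot m t (p + 1)"
    using ex_knot_span assms(2,3) by blast
  let ?f = "\<lambda>i. elem_sym h {i + 1..i + int n} (knot m t) * bspline_rec (knot m t) i n x"
  have "real (n choose h) * x ^ h = (\<Sum>i=p - int n..p. ?f i)"
    by (rule power_eq_sum_bspline_rec[OF assms(1) p(3,4) assms(4)])
  also have "\<dots> = (\<Sum>i=- int n..int m. ?f i)"
    using p by (intro sum.mono_neutral_left) (auto simp: bspline_rec_eq_0_outside[OF assms(1) p(3,4)])
  also have "\<dots> = (\<Sum>j=0..n + m. ?f (- int n + int j))"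
    by (rule sum.reindex_bij_witness[of _ "\<lambda>j. - int n + int j" "\<lambda>i. nat (i + int n)"]) auto
  also have "\<dots> = (\<Sum>j=0..n + m. elem_sym h (knot_indices n j) (knot m t)
                            * bspline_rec (knot m t) (- int n + int j) n x)"
    by (simp add: knot_indices_def)
  finally show ?thesis .
qed

lemma legendre_coeff_eq_sum_elem_sym:
  "legendre_coeff n \<tau> j i =
     (\<Sum>h\<le>i. pochhammer (- real i) h * pochhammer (real i + 1) h / (fact h)\<^sup>2
              / real (n choose h) * elem_sym h (knot_indices n j) \<tau>)"
  unfolding legendre_coeff_def elem_sym_def atLeast0AtMost
  by (simp add: mult.commute)

lemma shifted_legendre_eq_sum_bspline_rec:
  assumes "mono (knot m t)" and "0 \<le> x" and "x < 1" and "i \<le> n"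
  shows "shifted_legendre i x =
           (\<Sum>j=0..n + m. legendre_coeff n (knot m t) j i
                            * bspline_rec (knot m t) (- int n + int j) n x)"
proof -
  define c where "c h = pochhammer (- real i) h * pochhammer (real i + 1) h / (fact h)\<^sup>2" for h
  have "shifted_legendre i x = (\<Sum>h\<le>i. c h * x ^ h)"
    unfolding c_def by (rule shifted_legendre_eq_sum)
  also have "\<dots> = (\<Sum>h\<le>i. c h / real (n choose h) * (real (n choose h) * x ^ h))"
    using assms(4) by (intro sum.cong) auto
  also have "\<dots> = (\<Sum>h\<le>i. \<Sum>j=0..n + m. c h / real (n choose h) *
      (elem_sym h (knot_indices n j) (knot m t) * bspline_rec (knot m t) (- int n + int j) n x))"
    using assms(4)
    by (intro sum.cong refl)
       (simp only: power_eq_sum_bspline_rec_knot[OF assms(1-3)] atMost_iff le_trans sum_distrib_left)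
  also have "\<dots> = (\<Sum>j=0..n + m. legendre_coeff n (knot m t) j i
                            * bspline_rec (knot m t) (- int n + int j) n x)"
    unfolding legendre_coeff_eq_sum_elem_sym c_def[symmetric]
    by (subst sum.swap) (simp only: sum_distrib_right mult.assoc)
  finally show ?thesis .
qed

lemma bspline_rec_tendsto_bspline: "(bspline_rec \<tau> i d \<longlongrightarrow> bspline \<tau> i d 1) (at_left 1)"
proof -
  obtain l where l: "(bspline_rec \<tau> i d \<longlongrightarrow> l) (at_left 1)"
    using bspline_rec_left_limit by blast
  then have "Lim (at_left 1) (bspline_rec \<tau> i d) = l"
    by (intro tendsto_Lim) simp_all
  then show ?thesis using l by (simp add: bspline_def)
qed

lemma shifted_legendre_eq_sum_bspline:
  assumes "mono (knot m t)" and "0 \<le> x" and "x \<le> 1" and "i \<le> n"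
  shows "shifted_legendre i x =
           (\<Sum>j=0..n + m. legendre_coeff n (knot m t) j i
                            * bspline (knot m t) (- int n + int j) n x)"
proof (cases "x = 1")
  case False
  then show ?thesis
    using shifted_legendre_eq_sum_bspline_rec[OF assms(1,2) _ assms(4)] assms(3)
    by (simp add: bspline_def)
next
  case True
  let ?g = "\<lambda>y. \<Sum>j=0..n + m. legendre_coeff n (knot m t) j i
                            * bspline_rec (knot m t) (- int n + int j) n y"
  have "isCont (shifted_legendre i) 1"
    unfolding shifted_legendre_eq_sum[abs_def] by (intro continuous_intros)
  then have "(shifted_legendre i \<longlongrightarrow> shifted_legendre i 1) (at_left 1)"
    by (simp add: isCont_def filterlim_at_split)
  moreover have "eventually (\<lambda>y. shifted_legendre i y = ?g y) (at_left 1)"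
    using eventually_at_left_real[OF zero_less_one]
    by eventually_elim (rule shifted_legendre_eq_sum_bspline_rec[OF assms(1) _ _ assms(4)], simp_all)
  ultimately have "(?g \<longlongrightarrow> shifted_legendre i 1) (at_left 1)"
    by (rule Lim_transform_eventually)
  moreover have "(?g \<longlongrightarrow> (\<Sum>j=0..n + m. legendre_coeff n (knot m t) j i
                            * bspline (knot m t) (- int n + int j) n 1)) (at_left 1)"
    by (intro tendsto_intros bspline_rec_tendsto_bspline)
  ultimately show ?thesis
    unfolding True by (rule tendsto_unique[rotated]) simp
qed

lemma legendre_coeff_0: "legendre_coeff n \<tau> j 0 = 1"
proof -
  have "{S. S \<subseteq> knot_indices n j \<and> card S = 0} = {{}}"
    by (auto simp: knot_indices_def dest: finite_subset)
  then show ?thesis by (simp add: legendre_coeff_def)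
qed

theorem lemma3p1:
  fixes n m :: nat and t :: "nat \<Rightarrow> real"
  assumes "\<And>k. k \<in> {1..m} \<Longrightarrow> 0 < t k \<and> t k < 1"
    and "mono_on {1..m} t"
    and "\<And>v. card {k \<in> {1..m}. t k = v} \<le> n"
  shows "(\<forall>x\<in>{0..1}. shifted_legendre 0 x =
            (\<Sum>j=0..n + m. bspline (knot m t) (- int n + int j) n x)) \<and>
         (\<forall>i\<in>{1..n}. \<forall>x\<in>{0..1}. shifted_legendre i x =
            (\<Sum>j=0..n + m. legendre_coeff n (knot m t) j i
                             * bspline (knot m t) (- int n + int j) n x))"
proof -
  have "mono (knot m t)" using assms(1,2) by (rule mono_knot)
  note expand = shifted_legendre_eq_sum_bspline[OF this]
  show ?thesis
    using expand[where i = 0 and n = n] expand[where n = n] by (simp add: legendre_coeff_0)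
qed

end
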